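(* For each integer $m\ge 3$, let $P_m$ be the uniform distribution on the boundary of a regular $m$-sided polygon inscribed in a unit circle in $\mathbb{R}^2$, and let $Q_m=\lim_{n\to\infty} n^2V_n(P_m)$ be its quantization coefficient. Then $Q_m$ is an increasing function of $m$ for $m\ge 3$, and \[\lim_{m\to\infty}Q_m=\frac{\pi^2}{3},\] which is the quantization coefficient $\lim_{n\to\infty}n^2V_n$ for the uniform distribution on the unit circle.
   Context: For a Borel probability measure $P$ on $\mathbb{R}^2$ with Euclidean norm $\|\cdot\|$ and a finite nonempty set $\alpha\subset\mathbb{R}^2$, put $V(P;\alpha)=\int \min_{a\in\alpha}\|x-a\|^2\,dP(x)$. For $n\in\mathbb{N}$ the $n$th quantization error is $V_n(P)=\inf\{V(P;\alpha):\alpha\subset\mathbb{R}^2,\ 1\le \mathrm{card}(\alpha)\le n\}$. The quantization coefficient (of dimension $1$) of $P$ is $\lim_{n\to\infty}n^2V_n(P)$, if it exists; for the measures $P_m$ it exists and $Q_m=\frac13 m^2\sin^2\left(\frac{\pi}{m}\right)$. The uniform distribution on the boundary of a polygon, or on the unit circle, is the normalized arc-length measure on that curve. It is a previously known result that the quantization coefficient of the uniform distribution on the unit circle is $\frac{\pi^2}{3}$. *)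

theory Defs
  imports "HOL-Analysis.Analysis"
begin

text \<open>
  The integral is the Bochner integral, so \<open>distortion P \<alpha>\<close> is the intended value only for
  \<open>P\<close> with finite second moment; all measures considered below have compact support.
  The infimum is over the empty set for \<open>n = 0\<close>, which is irrelevant for limits.
\<close>

definition distortion :: "'a::euclidean_space measure \<Rightarrow> 'a set \<Rightarrow> real" where
  "distortion P \<alpha> = (\<integral>x. (MIN a\<in>\<alpha>. (norm (x - a))\<^sup>2) \<partial>P)"

definition quantization_error :: "nat \<Rightarrow> 'a::euclidean_space measure \<Rightarrow> real" where
  "quantization_error n P =
     Inf {distortion P \<alpha> | \<alpha>. finite \<alpha> \<and> 1 \<le> card \<alpha> \<and> card \<alpha> \<le> n}"

definition has_quantization_coefficient :: "'a::euclidean_space measure \<Rightarrow> real \<Rightarrow> bool" where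
  "has_quantization_coefficient P q \<longleftrightarrow>
     (\<lambda>n. (real n)\<^sup>2 * quantization_error n P) \<longlonglongrightarrow> q"

definition quantization_coefficient :: "'a::euclidean_space measure \<Rightarrow> real" where
  "quantization_coefficient P = lim (\<lambda>n. (real n)\<^sup>2 * quantization_error n P)"

text \<open>
  The arc-length measure of a piecewise continuously differentiable path \<open>g\<close> on \<open>[0,1]\<close> is the
  image under \<open>g\<close> of \<open>\<bar>g'(t)\<bar> dt\<close>.  This is the arc-length measure on the curve
  \<open>path_image g\<close> provided that \<open>g\<close> traverses that curve exactly once.
\<close>

definition arc_length_measure :: "(real \<Rightarrow> 'a::euclidean_space) \<Rightarrow> 'a measure" where
  "arc_length_measure g =
     distr (density (restrict_space lborel {0..1})
              (\<lambda>t. ennreal (norm (vector_derivative g (at t within {0..1}))))) borel g"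

definition uniform_on_curve :: "(real \<Rightarrow> 'a::euclidean_space) \<Rightarrow> 'a measure" where
  "uniform_on_curve g = uniform_measure (arc_length_measure g) (path_image g)"

definition unit_circle_point :: "real^2 \<Rightarrow> real \<Rightarrow> real^2" where
  "unit_circle_point c \<theta> = c + vector [cos \<theta>, sin \<theta>]"

definition regular_polygon_vertex :: "nat \<Rightarrow> real^2 \<Rightarrow> real \<Rightarrow> nat \<Rightarrow> real^2" where
  "regular_polygon_vertex m c \<phi> k = unit_circle_point c (\<phi> + 2 * pi * real k / real m)"

text \<open>
  The boundary of the regular \<open>m\<close>-gon with centre \<open>c\<close> and first vertex at angle \<open>\<phi>\<close>: for \<open>t\<close> in
  \<open>[k/m, (k+1)/m]\<close> the path runs along the side joining the \<open>k\<close>-th and the \<open>(k+1)\<close>-st vertex.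
\<close>

definition regular_polygon_path :: "nat \<Rightarrow> real^2 \<Rightarrow> real \<Rightarrow> real \<Rightarrow> real^2" where
  "regular_polygon_path m c \<phi> t =
     (let k = nat \<lfloor>real m * t\<rfloor>
      in linepath (regular_polygon_vertex m c \<phi> k) (regular_polygon_vertex m c \<phi> (Suc k))
           (real m * t - real k))"

definition unit_circle_path :: "real \<Rightarrow> real^2" where
  "unit_circle_path t = unit_circle_point 0 (2 * pi * t)"

definition uniform_regular_polygon :: "nat \<Rightarrow> real^2 \<Rightarrow> real \<Rightarrow> (real^2) measure" where
  "uniform_regular_polygon m c \<phi> = uniform_on_curve (regular_polygon_path m c \<phi>)"

definition uniform_unit_circle :: "(real^2) measure" where
  "uniform_unit_circle = uniform_on_curve unit_circle_path"

end

theory Submission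
  imports Defs
begin

section \<open>Distortion along a curve\<close>

text \<open>The coefficient sees only the length. A curve run through at constant speed
  \<open>L\<close> over \<open>{0..1}\<close>, made of pieces that are nearly straight and do not
  meet, has coefficient L^2/12, just like a straight segment of length \<open>L\<close> cut into
  \<open>n\<close> equal cells around their midpoints. This is
  \<open>has_quantization_coefficient_uniform_on_curve\<close>. The circle has L = 2 pi, which gives
  pi^2/3. The polygon has L = 2 m sin(pi/m), which gives Q_m = (m sin(pi/m))^2/3. Monotonicity is
  then the strict decrease of sin x / x on (0, pi] (\<open>mult_sin_less\<close>), and the limit is
  sin h / h -> 1 at 0.

  The upper bound takes the images of the midpoints of \<open>n\<close> equal parameter cells and
  uses that the curve is Lipschitz (\<open>distortion_midpoints_le\<close>). The lower bound
  (\<open>eventually_distortion_ge\<close>) must hold for every set of at most \<open>n\<close>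
  points. For a radius \<open>r\<close>, the squared distance to the nearest point is at least r^2
  minus the sum of the tents max(0, r^2 - d_a^2), so each point can remove only the integral of its
  tent. On a piece that advances in a fixed direction at rate at least \<open>K\<close> this
  integral is at most 4 r^3 / (3 K) (\<open>integral_tent_le\<close>). Once \<open>r\<close> is
  small compared with the distance between the slightly shrunken pieces, a tent meets only one of
  them. Taking \<open>r\<close> of order 1/n gives a bound that tends to L^2/12 after
  \<open>K\<close> tends to \<open>L\<close> and the shrinking factor to 1.\<close>

lemma continuous_on_Min_norm_diff:
  fixes \<alpha> :: "'a::euclidean_space set"
  assumes "finite \<alpha>" "\<alpha> \<noteq> {}" and g: "continuous_on S g"
  shows "continuous_on S (\<lambda>t. MIN a\<in>\<alpha>. (norm (g t - a))\<^sup>2)"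
  using assms(1,2)
proof (induction rule: finite_ne_induct)
  case (singleton a)
  show ?case by (simp, intro continuous_intros g)
next
  case (insert a F)
  then show ?case
    by (simp, intro continuous_intros g insert.IH)
qed

lemma integral_unit_interval_partition:
  fixes f :: "real \<Rightarrow> real"
  assumes "f integrable_on {0..1}" and N: "N > 0"
  shows "integral {0..1} f = (\<Sum>j<N. integral {real j / real N..real (Suc j) / real N} f)"
proof -
  have "integral {0..real k / real N} f = (\<Sum>j<k. integral {real j / real N..real (Suc j) / real N} f)"
    if "k \<le> N" for k
    using that
  proof (induction k)
    case (Suc k)
    have "f integrable_on {0..real (Suc k) / real N}"
      using integrable_on_subinterval[OF assms(1)] Suc.prems N by (auto simp: field_simps)
    then show ?case
      using Henstock_Kurzweil_Integration.integral_combine[where a = 0 and c = "real k / real N" and b = "real (Suc k) / real N" and f = f] Suc N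
      by (simp add: divide_right_mono)
  qed simp
  from this[of N] N show ?thesis by simp
qed

text \<open>At constant speed the arc-length measure is \<open>L\<close> times the image of Lebesgue
  measure, and normalising cancels \<open>L\<close>. The finite set \<open>X\<close> makes room for
  corners; it is a null set.\<close>

lemma uniform_on_curve_eq_distr:
  fixes g :: "real \<Rightarrow> 'a::euclidean_space"
  assumes cont: "continuous_on {0..1} g" and "finite X" and "L > 0"
    and speed: "\<And>t. t \<in> {0..1} - X \<Longrightarrow> norm (vector_derivative g (at t within {0..1})) = L"
  shows "uniform_on_curve g = distr (restrict_space lborel {0..1}) borel g"
proof -
  define I where "I = restrict_space lborel {0..1::real}"
  define F where "F = (\<lambda>t. ennreal (norm (vector_derivative g (at t within {0..1}))))"
  have g[measurable]: "g \<in> borel_measurable I"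
    using borel_measurable_continuous_on_restrict[OF cont]
    by (simp add: I_def cong: measurable_cong_sets sets_restrict_space_cong)
  have X: "countable (X \<inter> {0..1})" using \<open>finite X\<close> by (simp add: countable_finite)
  have sing: "{x} \<in> sets I" if "x \<in> X \<inter> {0..1}" for x
    using that by (auto simp: I_def sets_restrict_space_iff)
  have FL: "F t = ennreal L" if "t \<in> space I" "t \<notin> X \<inter> {0..1}" for t
  proof -
    have "t \<in> {0..1} - X" using that by (simp add: I_def)
    then show ?thesis unfolding F_def by (simp only: speed)
  qed
  have F[measurable]: "F \<in> borel_measurable I"
    by (rule measurable_discrete_difference[of "\<lambda>_. ennreal L" _ _ "X \<inter> {0..1}"])
       (use X sing FL in auto)
  have "X \<inter> {0..1} \<in> null_sets I"
    using \<open>finite X\<close> finite_imp_null_set_lborel[of "X \<inter> {0..1}"]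
    by (simp add: I_def null_sets_restrict_space)
  moreover have "{t \<in> space I. F t \<noteq> ennreal L} \<subseteq> X \<inter> {0..1}"
    using FL by blast
  ultimately have ae: "AE t in I. F t = ennreal L"
    by (rule AE_I')
  have I1: "emeasure I (space I) = 1"
    by (simp add: I_def emeasure_restrict_space)
  have em: "emeasure (arc_length_measure g) B = ennreal L * emeasure I (g -` B \<inter> space I)"
    if [measurable]: "B \<in> sets borel" for B
  proof -
    have S: "g -` B \<inter> space I \<in> sets I" by measurable
    have ae': "AE t in I. F t * indicator (g -` B \<inter> space I) t = ennreal L * indicator (g -` B \<inter> space I) t"
      using ae by eventually_elim simp
    have "emeasure (arc_length_measure g) B = emeasure (density I F) (g -` B \<inter> space I)"
      unfolding arc_length_measure_def F_def[symmetric] I_def[symmetric]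
      by (subst emeasure_distr) auto
    also have "\<dots> = (\<integral>\<^sup>+t. ennreal L * indicator (g -` B \<inter> space I) t \<partial>I)"
      using F S by (subst emeasure_density) (auto intro: nn_integral_cong_AE ae')
    also have "\<dots> = ennreal L * emeasure I (g -` B \<inter> space I)"
      using S by (rule nn_integral_cmult_indicator)
    finally show ?thesis .
  qed
  have pi: "path_image g \<in> sets borel"
    using compact_path_image[of g] cont by (auto simp: path_def intro: borel_closed compact_imp_closed)
  \<comment> \<open>The path image pulls back to the whole parameter interval, so the normalising
    mass is exactly \<open>L\<close>.\<close>
  have sp: "g -` (path_image g \<inter> B) \<inter> space I = g -` B \<inter> space I" for B
    by (auto simp: path_image_def I_def)
  have sa: "sets (arc_length_measure g) = sets borel"
    by (simp add: arc_length_measure_def)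
  have "emeasure (uniform_on_curve g) B = emeasure (distr I borel g) B"
    if B: "B \<in> sets borel" for B
  proof -
    have "emeasure (uniform_on_curve g) B
        = ennreal L * emeasure I (g -` B \<inter> space I) / (ennreal L * emeasure I (g -` UNIV \<inter> space I))"
      unfolding uniform_on_curve_def
      using em[of "path_image g \<inter> B"] em[of "path_image g"] B pi sp[of B] sp[of UNIV] sa
      by (simp add: emeasure_uniform_measure)
    also have "\<dots> = emeasure I (g -` B \<inter> space I)"
      using \<open>L > 0\<close> I1 ennreal_mult_divide_eq[of "ennreal L" "emeasure I (g -` B \<inter> space I)"]
      by (simp add: mult.commute)
    also have "\<dots> = emeasure (distr I borel g) B"
      using B by (simp add: emeasure_distr)
    finally show ?thesis .
  qed
  then show ?thesis
    unfolding I_def[symmetric]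
    by (intro measure_eqI) (auto simp: uniform_on_curve_def uniform_measure_def sa)
qed

text \<open>Turns the distortion into an integral over the parameter interval, where all later
  estimates take place.\<close>

lemma distortion_uniform_on_curve:
  fixes g :: "real \<Rightarrow> 'a::euclidean_space"
  assumes cont: "continuous_on {0..1} g" and "finite X" and "L > 0"
    and speed: "\<And>t. t \<in> {0..1} - X \<Longrightarrow> norm (vector_derivative g (at t within {0..1})) = L"
    and "finite \<alpha>" "\<alpha> \<noteq> {}"
  shows "distortion (uniform_on_curve g) \<alpha> = integral {0..1} (\<lambda>t. MIN a\<in>\<alpha>. (norm (g t - a))\<^sup>2)"
proof -
  have g: "g \<in> borel_measurable (restrict_space lborel {0..1})"
    using borel_measurable_continuous_on_restrict[OF cont]
    by (simp cong: measurable_cong_sets sets_restrict_space_cong)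
  have distr: "uniform_on_curve g = distr (restrict_space lborel {0..1}) borel g"
    by (rule uniform_on_curve_eq_distr[OF cont \<open>finite X\<close> \<open>L > 0\<close> speed])
  have "(\<lambda>x::'a. MIN a\<in>\<alpha>. (norm (x - a))\<^sup>2) \<in> borel_measurable borel"
    by (intro borel_measurable_continuous_onI continuous_on_Min_norm_diff assms continuous_intros)
  then have "distortion (uniform_on_curve g) \<alpha>
      = (LINT t:{0..1}|lborel. MIN a\<in>\<alpha>. (norm (g t - a))\<^sup>2)"
    unfolding distortion_def distr set_lebesgue_integral_def
    using g by (simp add: integral_distr integral_restrict_space)
  also have "\<dots> = integral {0..1} (\<lambda>t. MIN a\<in>\<alpha>. (norm (g t - a))\<^sup>2)"
    by (intro set_borel_integral_eq_integral borel_integrable_atLeastAtMost'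
        continuous_on_Min_norm_diff assms)
  finally show ?thesis .
qed

lemma distortion_nonneg:
  assumes "finite \<alpha>" "\<alpha> \<noteq> {}"
  shows "distortion P \<alpha> \<ge> 0"
  unfolding distortion_def using assms by (intro Bochner_Integration.integral_nonneg) (auto simp: Min_ge_iff)

section \<open>Upper bound\<close>

lemma has_integral_square_midpoint:
  fixes m h :: real
  assumes "h \<ge> 0"
  shows "((\<lambda>t. (t - m)\<^sup>2) has_integral 2 * h ^ 3 / 3) {m - h..m + h}"
proof -
  have "((\<lambda>t. (t - m)\<^sup>2) has_integral ((m + h - m) ^ 3 / 3 - (m - h - m) ^ 3 / 3)) {m - h..m + h}"
    using assms
    by (intro fundamental_theorem_of_calculus)
       (auto intro!: derivative_eq_intros simp flip: has_real_derivative_iff_has_vector_derivative)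
  then show ?thesis by (simp add: power3_eq_cube mult.assoc)
qed

text \<open>In a cell with midpoint \<open>m\<close> and half-length h = 1/(2n), the Lipschitz bound
  puts g(t) within L |t - m| of the code point g(m), so the cell costs at most L^2 times 2 h^3 / 3.
  There are \<open>n\<close> cells.\<close>

lemma distortion_midpoints_le:
  fixes g :: "real \<Rightarrow> 'a::euclidean_space"
  assumes lip: "L-lipschitz_on {0..1} g" and n: "n > 0"
  defines "\<alpha> \<equiv> (\<lambda>i. g ((2 * real i + 1) / (2 * real n))) ` {..<n}"
  shows "integral {0..1} (\<lambda>t. MIN a\<in>\<alpha>. (norm (g t - a))\<^sup>2) \<le> L\<^sup>2 / (12 * (real n)\<^sup>2)"
proof -
  define f where "f = (\<lambda>t. MIN a\<in>\<alpha>. (norm (g t - a))\<^sup>2)"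
  have \<alpha>: "finite \<alpha>" "\<alpha> \<noteq> {}" using n by (auto simp: \<alpha>_def)
  have cont: "continuous_on {0..1} f"
    unfolding f_def by (intro continuous_on_Min_norm_diff \<alpha> lipschitz_on_continuous_on[OF lip])
  have piece: "integral {real j / real n..real (Suc j) / real n} f \<le> L\<^sup>2 / (12 * real n ^ 3)"
    if j: "j < n" for j
  proof -
    define m where "m = (2 * real j + 1) / (2 * real n)"
    define h where "h = 1 / (2 * real n)"
    have eq: "{real j / real n..real (Suc j) / real n} = {m - h..m + h}"
      using n by (simp add: m_def h_def field_simps)
    have sub: "{m - h..m + h} \<subseteq> {0..1}"
      unfolding eq[symmetric] using j n by (auto simp: field_simps intro: order_trans)
    have m01: "m \<in> {0..1}" by (rule subsetD[OF sub]) (simp add: h_def)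
    have hi: "((\<lambda>t. L\<^sup>2 * (t - m)\<^sup>2) has_integral L\<^sup>2 * (2 * h ^ 3 / 3)) {m - h..m + h}"
      by (intro has_integral_mult_right has_integral_square_midpoint) (simp add: h_def)
    have "integral {m - h..m + h} f \<le> L\<^sup>2 * (2 * h ^ 3 / 3)"
    proof (rule has_integral_le[OF integrable_integral hi])
      show "f integrable_on {m - h..m + h}"
        by (intro integrable_continuous_interval continuous_on_subset[OF cont sub])
      fix t assume t: "t \<in> {m - h..m + h}"
      have "g m \<in> \<alpha>" using j by (auto simp: \<alpha>_def m_def)
      then have "f t \<le> (norm (g t - g m))\<^sup>2"
        unfolding f_def using \<alpha> by (intro Min_le) auto
      also have "norm (g t - g m) \<le> L * \<bar>t - m\<bar>"
        using lipschitz_onD[OF lip, of t m] t sub m01 by (auto simp: dist_norm)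
      then have "(norm (g t - g m))\<^sup>2 \<le> (L * \<bar>t - m\<bar>)\<^sup>2"
        by (intro power_mono) auto
      finally show "f t \<le> L\<^sup>2 * (t - m)\<^sup>2" by (simp add: power_mult_distrib)
    qed
    also have "\<dots> = L\<^sup>2 / (12 * real n ^ 3)"
      using n by (simp add: h_def field_simps power3_eq_cube)
    finally show ?thesis unfolding eq .
  qed
  have "integral {0..1} f \<le> (\<Sum>j<n. L\<^sup>2 / (12 * real n ^ 3))"
    by (subst integral_unit_interval_partition[OF integrable_continuous_interval[OF cont] n])
       (intro sum_mono piece, simp)
  also have "\<dots> = L\<^sup>2 / (12 * (real n)\<^sup>2)"
    using n by (simp add: field_simps power3_eq_cube power2_eq_square)
  finally show ?thesis by (simp add: f_def)
qed

section \<open>Lower bound\<close>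

text \<open>Take for \<open>t0\<close> the parameter at which \<open>h\<close> comes closest to
  \<open>b\<close>: a preimage of \<open>b\<close> if \<open>b\<close> lies in the range, and
  otherwise the end of the interval whose value is nearer.\<close>

lemma expanding_abs_diff_ge:
  fixes h :: "real \<Rightarrow> real"
  assumes "A \<le> B" and cont: "continuous_on {A..B} h"
    and exp: "\<And>s t. A \<le> s \<Longrightarrow> s \<le> t \<Longrightarrow> t \<le> B \<Longrightarrow> K * (t - s) \<le> h t - h s"
    and "K > 0"
  shows "\<exists>t0. \<forall>t\<in>{A..B}. K * \<bar>t - t0\<bar> \<le> \<bar>h t - b\<bar>"
proof -
  consider "b < h A" | "h B < b" | "h A \<le> b" "b \<le> h B" by linarith
  then show ?thesis
  proof cases
    case 1
    then show ?thesis by (intro exI[of _ A]) (use exp[of A] in force)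
  next
    case 2
    then show ?thesis by (intro exI[of _ B]) (use exp[of _ B] in force)
  next
    case 3
    then obtain t0 where t0: "A \<le> t0" "t0 \<le> B" "h t0 = b"
      using IVT'[of h A b B] assms(1) cont by auto
    have "K * \<bar>t - t0\<bar> \<le> \<bar>h t - b\<bar>" if "t \<in> {A..B}" for t
      using exp[of t t0] exp[of t0 t] t0 that by (cases "t \<le> t0") auto
    then show ?thesis by blast
  qed
qed

text \<open>Projection onto the unit vector \<open>v\<close> shortens distances, so
  \<open>norm (g t - a)\<close> is at least \<open>K * \<bar>t - t0\<bar>\<close> for a suitable
  \<open>t0\<close>. The tent therefore lies under a parabola of height r^2 and half-width r/K,
  whose area is 4 r^3 / (3 K).\<close>

lemma integral_tent_le:
  fixes g :: "real \<Rightarrow> 'a::euclidean_space"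
  assumes "A \<le> B" and cont: "continuous_on {A..B} g" and v: "norm v = 1"
    and exp: "\<And>s t. A \<le> s \<Longrightarrow> s \<le> t \<Longrightarrow> t \<le> B \<Longrightarrow> K * (t - s) \<le> v \<bullet> (g t - g s)"
    and K: "K > 0" and r: "r \<ge> 0"
  shows "integral {A..B} (\<lambda>t. max 0 (r\<^sup>2 - (norm (g t - a))\<^sup>2)) \<le> 4 * r ^ 3 / (3 * K)"
proof -
  have "\<exists>t0. \<forall>t\<in>{A..B}. K * \<bar>t - t0\<bar> \<le> \<bar>v \<bullet> g t - v \<bullet> a\<bar>"
    by (rule expanding_abs_diff_ge)
       (use assms in \<open>auto intro!: continuous_intros simp: inner_diff_right\<close>)
  then obtain t0 where t0: "\<And>t. t \<in> {A..B} \<Longrightarrow> K * \<bar>t - t0\<bar> \<le> \<bar>v \<bullet> g t - v \<bullet> a\<bar>" by blast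
  define J where "J = {t0 - r / K..t0 + r / K}"
  \<comment> \<open>The interval \<open>J\<close> may stick out of \<open>{A..B}\<close>, so the
    parabola is extended by 0 and its area is taken over the whole line.\<close>
  define q where "q = (\<lambda>t. if t \<in> J then r\<^sup>2 - K\<^sup>2 * (t - t0)\<^sup>2 else 0)"
  have inJ: "t \<in> J \<longleftrightarrow> K * \<bar>t - t0\<bar> \<le> r" for t
  proof -
    have "t \<in> J \<longleftrightarrow> \<bar>t - t0\<bar> \<le> r / K" by (auto simp: J_def)
    also have "\<dots> \<longleftrightarrow> K * \<bar>t - t0\<bar> \<le> r" using K by (simp add: field_simps)
    finally show ?thesis .
  qed
  have sq: "K * \<bar>t - t0\<bar> \<le> r \<Longrightarrow> K\<^sup>2 * (t - t0)\<^sup>2 \<le> r\<^sup>2" for t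
    using power_mono[of "K * \<bar>t - t0\<bar>" r 2] K by (simp add: power_mult_distrib)
  have qnn: "q t \<ge> 0" for t
    using sq[of t] by (auto simp: q_def inJ)
  have "((\<lambda>t. r\<^sup>2 - K\<^sup>2 * (t - t0)\<^sup>2) has_integral
      (r\<^sup>2 * (2 * (r / K)) - K\<^sup>2 * (2 * (r / K) ^ 3 / 3))) J"
    unfolding J_def using K r has_integral_const_real[of "r\<^sup>2" "t0 - r / K" "t0 + r / K"]
    by (intro has_integral_diff has_integral_mult_right has_integral_square_midpoint)
       (auto simp: mult.commute)
  also have "r\<^sup>2 * (2 * (r / K)) - K\<^sup>2 * (2 * (r / K) ^ 3 / 3) = 4 * r ^ 3 / (3 * K)"
    using K by (simp add: field_simps power3_eq_cube power2_eq_square)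
  finally have hq: "(q has_integral 4 * r ^ 3 / (3 * K)) UNIV"
    unfolding q_def by (simp add: has_integral_restrict_UNIV)
  have qAB: "q integrable_on {A..B}"
    using hq by (auto intro: integrable_on_subinterval)
  have "integral {A..B} (\<lambda>t. max 0 (r\<^sup>2 - (norm (g t - a))\<^sup>2)) \<le> integral {A..B} q"
  proof (rule integral_le)
    show "(\<lambda>t. max 0 (r\<^sup>2 - (norm (g t - a))\<^sup>2)) integrable_on {A..B}"
      by (intro integrable_continuous_interval continuous_intros cont)
    fix t assume t: "t \<in> {A..B}"
    have "\<bar>v \<bullet> (g t - a)\<bar> \<le> norm (g t - a)"
      using Cauchy_Schwarz_ineq2[of v "g t - a"] v by simp
    then have *: "K * \<bar>t - t0\<bar> \<le> norm (g t - a)"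
      using t0[OF t] by (simp add: inner_diff_right)
    then have sq2: "K\<^sup>2 * (t - t0)\<^sup>2 \<le> (norm (g t - a))\<^sup>2"
      using power_mono[of "K * \<bar>t - t0\<bar>" "norm (g t - a)" 2] K by (simp add: power_mult_distrib)
    show "max 0 (r\<^sup>2 - (norm (g t - a))\<^sup>2) \<le> q t"
    proof (cases "t \<in> J")
      case True
      then show ?thesis using qnn[of t] sq2 by (simp add: q_def)
    next
      case False
      then have "r \<le> norm (g t - a)" using * by (simp add: inJ)
      then have "r\<^sup>2 \<le> (norm (g t - a))\<^sup>2" using r by (intro power_mono) auto
      then show ?thesis using qnn[of t] by simp
    qed
  qed (rule qAB)
  also have "\<dots> \<le> integral UNIV q"
    by (rule integral_subset_le) (use qAB hq qnn in auto)
  also have "\<dots> = 4 * r ^ 3 / (3 * K)" using hq by (rule integral_unique)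
  finally show ?thesis .
qed

lemma finite_family_compact_separated:
  fixes S :: "nat \<Rightarrow> 'a::euclidean_space set"
  assumes "\<And>j. j < N \<Longrightarrow> compact (S j)"
    and "\<And>i j. i < N \<Longrightarrow> j < N \<Longrightarrow> i \<noteq> j \<Longrightarrow> S i \<inter> S j = {}"
  shows "\<exists>d>0. \<forall>i<N. \<forall>j<N. i \<noteq> j \<longrightarrow> (\<forall>x\<in>S i. \<forall>y\<in>S j. d \<le> dist x y)"
proof -
  have "\<exists>d>0. \<forall>x\<in>S i. \<forall>y\<in>S j. d \<le> dist x y" if "i < N" "j < N" "i \<noteq> j" for i j
    using separate_compact_closed[of "S i" "S j"] assms that compact_imp_closed by blast
  then obtain d where d: "\<And>i j. i < N \<Longrightarrow> j < N \<Longrightarrow> i \<noteq> j \<Longrightarrow>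
      d i j > 0 \<and> (\<forall>x\<in>S i. \<forall>y\<in>S j. d i j \<le> dist x y)" by metis
  \<comment> \<open>The inserted 1 keeps the minimum defined when there is no pair of distinct
    indices.\<close>
  define D where "D = insert 1 ((\<lambda>(i, j). d i j) ` {(i, j). i < N \<and> j < N \<and> i \<noteq> j})"
  have "finite {(i, j). i < N \<and> j < N \<and> i \<noteq> j}"
    by (rule finite_subset[of _ "{..<N} \<times> {..<N}"]) auto
  then have D: "finite D" "D \<noteq> {}" by (auto simp: D_def)
  have "Min D > 0" using D d by (auto simp: Min_gr_iff) (auto simp: D_def d)
  moreover have "Min D \<le> dist x y" if "i < N" "j < N" "i \<noteq> j" "x \<in> S i" "y \<in> S j" for i j x y
  proof -
    have "Min D \<le> d i j" using D(1) that by (intro Min_le) (auto simp: D_def)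
    also have "\<dots> \<le> dist x y" using d that by blast
    finally show ?thesis .
  qed
  ultimately show ?thesis by blast
qed

text \<open>
  With \<open>d\<^sub>a t = norm (g t - a)\<close>, every radius \<open>r\<close> satisfies
  \<open>min\<^sub>a d\<^sub>a\<^sup>2 \<ge> r\<^sup>2 - (\<Sum>a. max 0 (r\<^sup>2 - d\<^sub>a\<^sup>2))\<close>. If \<open>r\<close> is small, then each \<open>a\<close> sees only one of the shrunken
  pieces, so its summand has integral at most \<open>4 r\<^sup>3 / (3 K)\<close>; the choice \<open>r = K \<kappa> / (2 n)\<close> maximises
  the resulting bound \<open>r\<^sup>2 \<kappa> - 4 n r\<^sup>3 / (3 K)\<close>.
\<close>

lemma eventually_distortion_ge:
  fixes g :: "real \<Rightarrow> 'a::euclidean_space"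
  assumes cont: "continuous_on {0..1} g" and N: "N > 0" and K: "K > 0" and \<kappa>: "0 < \<kappa>" "\<kappa> < 1"
    and v: "\<And>j. j < N \<Longrightarrow> norm (v j) = 1"
    and exp: "\<And>j s t. j < N \<Longrightarrow> real j / real N \<le> s \<Longrightarrow> s \<le> t \<Longrightarrow> t \<le> real (Suc j) / real N \<Longrightarrow>
                K * (t - s) \<le> v j \<bullet> (g t - g s)"
    and inj: "\<And>i j s t. i < N \<Longrightarrow> j < N \<Longrightarrow> i \<noteq> j \<Longrightarrow>
                s \<in> {real i / real N<..<real (Suc i) / real N} \<Longrightarrow>
                t \<in> {real j / real N<..<real (Suc j) / real N} \<Longrightarrow> g s \<noteq> g t"
  shows "\<forall>\<^sub>F n in sequentially. \<forall>\<alpha>. finite \<alpha> \<and> 1 \<le> card \<alpha> \<and> card \<alpha> \<le> n \<longrightarrow>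
           K\<^sup>2 * \<kappa> ^ 3 / (12 * (real n)\<^sup>2) \<le> integral {0..1} (\<lambda>t. MIN a\<in>\<alpha>. (norm (g t - a))\<^sup>2)"
proof -
  \<comment> \<open>Each piece is shrunk about its middle by the factor \<kappa>. Neighbouring
    pieces touch at their ends, but the shrunken ones are compact subsets of the open pieces, so
    their images have a positive distance \<open>d\<close>.\<close>
  define A where "A = (\<lambda>j. (real j + (1 - \<kappa>) / 2) / real N)"
  define B where "B = (\<lambda>j. (real j + (1 + \<kappa>) / 2) / real N)"
  have AB: "A j < B j" "real j / real N < A j" "B j < real (Suc j) / real N" "B j - A j = \<kappa> / real N" for j
    using N \<kappa> by (auto simp: A_def B_def field_simps)
  have big: "{real j / real N..real (Suc j) / real N} \<subseteq> {0..1}" if "j < N" for j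
    using that N by (auto simp: field_simps intro: order_trans)
  have sub: "{A j..B j} \<subseteq> {real j / real N..real (Suc j) / real N}" for j
    using AB[of j] by auto
  have contj: "continuous_on {A j..B j} g" if "j < N" for j
    using continuous_on_subset[OF cont] big[OF that] sub[of j] by blast
  have "\<exists>d>0. \<forall>i<N. \<forall>j<N. i \<noteq> j \<longrightarrow> (\<forall>x\<in>g ` {A i..B i}. \<forall>y\<in>g ` {A j..B j}. d \<le> dist x y)"
  proof (rule finite_family_compact_separated)
    show "compact (g ` {A j..B j})" if "j < N" for j
      using contj[OF that] by (intro compact_continuous_image) auto
    fix i j assume ij: "i < N" "j < N" "i \<noteq> j"
    have "g s \<noteq> g t" if "s \<in> {A i..B i}" "t \<in> {A j..B j}" for s t
      using inj[OF ij, of s t] that AB[of i] AB[of j] by auto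
    then show "g ` {A i..B i} \<inter> g ` {A j..B j} = {}" by auto
  qed
  then obtain d where d: "d > 0" and sep0: "\<forall>i<N. \<forall>j<N. i \<noteq> j \<longrightarrow>
      (\<forall>x\<in>g ` {A i..B i}. \<forall>y\<in>g ` {A j..B j}. d \<le> dist x y)" by (elim exE conjE)
  have sep: "d \<le> dist (g s) (g t)"
    if "i < N" "j < N" "i \<noteq> j" "s \<in> {A i..B i}" "t \<in> {A j..B j}" for i j s t
    using sep0[rule_format, OF that(1-3) imageI imageI, OF that(4,5)] .
  \<comment> \<open>Two curve points closer than \<open>r\<close> to \<open>a\<close> are closer
    than \<open>2 * r\<close> to each other, hence closer than \<open>d\<close>, and so belong to
    the same shrunken piece: at most one summand is nonzero.\<close>
  have tent_sum: "(\<Sum>j<N. integral {A j..B j} (\<lambda>t. max 0 (r\<^sup>2 - (norm (g t - a))\<^sup>2))) \<le> 4 * r ^ 3 / (3 * K)"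
    if r: "0 < r" "2 * r \<le> d" for r a
  proof -
    define p where "p = (\<lambda>t. max 0 (r\<^sup>2 - (norm (g t - a))\<^sup>2))"
    have close: "norm (g t - a) < r" if "p t \<noteq> 0" for t
      using that r power_mono[of r "norm (g t - a)" 2] by (fastforce simp: p_def)
    have one: "integral {A j..B j} p \<le> 4 * r ^ 3 / (3 * K)" if j: "j < N" for j
      unfolding p_def
    proof (rule integral_tent_le[where v = "v j"])
      fix s t assume "A j \<le> s" "s \<le> t" "t \<le> B j"
      then show "K * (t - s) \<le> v j \<bullet> (g t - g s)"
        using AB[of j] by (intro exp j) auto
    qed (use AB[of j] contj[OF j] v[OF j] K r in auto)
    have "(\<Sum>j<N. integral {A j..B j} p) \<le> 4 * r ^ 3 / (3 * K)"
    proof (cases "\<exists>i<N. \<exists>s\<in>{A i..B i}. p s \<noteq> 0")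
      case True
      then obtain i s where i: "i < N" "s \<in> {A i..B i}" "p s \<noteq> 0" by blast
      have "integral {A j..B j} p = 0" if j: "j < N" "j \<noteq> i" for j
      proof -
        have "p t = 0" if t: "t \<in> {A j..B j}" for t
        proof (rule ccontr)
          assume "p t \<noteq> 0"
          then have "norm (g t - a) < r" "norm (g s - a) < r" using close i by auto
          then have "dist (g t) (g s) < d"
            using r dist_triangle2[of "g t" "g s" a] by (simp add: dist_norm)
          then show False using sep[OF j(1) i(1) j(2) t i(2)] by simp
        qed
        then show ?thesis by (intro integral_unique has_integral_is_0) auto
      qed
      then have "(\<Sum>j<N. integral {A j..B j} p) = (\<Sum>j\<in>{i}. integral {A j..B j} p)"
        using i by (intro sum.mono_neutral_right) auto
      then show ?thesis using one[OF i(1)] by simp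
    next
      case False
      then have "integral {A j..B j} p = 0" if "j < N" for j
        using that by (intro integral_unique has_integral_is_0) auto
      then show ?thesis using r K by simp
    qed
    then show ?thesis by (simp add: p_def)
  qed
  \<comment> \<open>The condition \<open>K * \<kappa> / real n \<le> d\<close> is
    \<open>2 * r \<le> d\<close> for the radius chosen below; it makes the bound an eventual
    one.\<close>
  have main: "K\<^sup>2 * \<kappa> ^ 3 / (12 * (real n)\<^sup>2) \<le> integral {0..1} (\<lambda>t. MIN a\<in>\<alpha>. (norm (g t - a))\<^sup>2)"
    if n: "n > 0" "K * \<kappa> / real n \<le> d" and \<alpha>: "finite \<alpha>" "1 \<le> card \<alpha>" "card \<alpha> \<le> n" for n \<alpha>
  proof -
    define r where "r = K * \<kappa> / (2 * real n)"
    have r: "r > 0" "2 * r \<le> d" using n K \<kappa> by (auto simp: r_def)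
    define f where "f = (\<lambda>t. MIN a\<in>\<alpha>. (norm (g t - a))\<^sup>2)"
    define p where "p = (\<lambda>a t. max 0 (r\<^sup>2 - (norm (g t - a))\<^sup>2))"
    have ne: "\<alpha> \<noteq> {}" using \<alpha> by auto
    have contf: "continuous_on {0..1} f"
      unfolding f_def by (intro continuous_on_Min_norm_diff \<alpha> ne cont)
    have intf: "f integrable_on S" if "S \<subseteq> {0..1}" "S = {x..y}" for S x y
      using that by (auto intro!: integrable_continuous_interval continuous_on_subset[OF contf])
    have fnn: "f t \<ge> 0" for t
      unfolding f_def using \<alpha> ne by (auto simp: Min_ge_iff)
    have intp: "p a integrable_on {A j..B j}" if "j < N" for a j
      unfolding p_def by (intro integrable_continuous_interval continuous_intros contj that)
    \<comment> \<open>The tent of the nearest point alone already lowers r^2 to at most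
      \<open>f t\<close>, and the other tents are nonnegative.\<close>
    have flow: "r\<^sup>2 - (\<Sum>a\<in>\<alpha>. p a t) \<le> f t" for t
    proof -
      have "f t \<in> (\<lambda>a. (norm (g t - a))\<^sup>2) ` \<alpha>"
        unfolding f_def using \<alpha> ne by (intro Min_in) auto
      then obtain a where a: "a \<in> \<alpha>" "f t = (norm (g t - a))\<^sup>2" by blast
      have "p a t \<le> (\<Sum>a\<in>\<alpha>. p a t)"
        using a \<alpha> by (intro member_le_sum) (auto simp: p_def)
      then show ?thesis using a by (simp add: p_def)
    qed
    \<comment> \<open>The tent bound is integrated over the shrunken piece only; on the two
      discarded ends \<open>f\<close> is just bounded below by 0.\<close>
    have piece: "r\<^sup>2 * (\<kappa> / real N) - (\<Sum>a\<in>\<alpha>. integral {A j..B j} (p a)) \<le> integral {real j / real N..real (Suc j) / real N} f"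
      if j: "j < N" for j
    proof -
      have "((\<lambda>t. r\<^sup>2 - (\<Sum>a\<in>\<alpha>. p a t)) has_integral
          (r\<^sup>2 * (B j - A j) - (\<Sum>a\<in>\<alpha>. integral {A j..B j} (p a)))) {A j..B j}"
        using AB(1)[of j] has_integral_const_real[of "r\<^sup>2" "A j" "B j"]
        by (intro has_integral_diff has_integral_sum \<alpha> integrable_integral intp j)
           (auto simp: mult.commute)
      then have "r\<^sup>2 * (B j - A j) - (\<Sum>a\<in>\<alpha>. integral {A j..B j} (p a)) \<le> integral {A j..B j} f"
        by (rule has_integral_le[OF _ integrable_integral]) (use intf big[OF j] sub[of j] flow in blast)+
      also have "\<dots> \<le> integral {real j / real N..real (Suc j) / real N} f"
        by (rule integral_subset_le) (use intf big[OF j] sub[of j] fnn in blast)+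
      finally show ?thesis by (simp add: AB)
    qed
    have "r\<^sup>2 * \<kappa> - real n * (4 * r ^ 3 / (3 * K)) \<le> r\<^sup>2 * \<kappa> - real (card \<alpha>) * (4 * r ^ 3 / (3 * K))"
      using \<alpha> r K \<kappa> by (intro diff_mono mult_right_mono) auto
    also have "\<dots> = r\<^sup>2 * \<kappa> - (\<Sum>a\<in>\<alpha>. 4 * r ^ 3 / (3 * K))"
      by simp
    also have "\<dots> \<le> r\<^sup>2 * \<kappa> - (\<Sum>a\<in>\<alpha>. \<Sum>j<N. integral {A j..B j} (p a))"
      unfolding p_def by (intro diff_mono sum_mono tent_sum r order_refl)
    also have "\<dots> = (\<Sum>j<N. r\<^sup>2 * (\<kappa> / real N) - (\<Sum>a\<in>\<alpha>. integral {A j..B j} (p a)))"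
      using N by (simp add: sum_subtractf sum.swap[of _ \<alpha>])
    also have "\<dots> \<le> (\<Sum>j<N. integral {real j / real N..real (Suc j) / real N} f)"
      by (intro sum_mono piece) simp
    also have "\<dots> = integral {0..1} f"
      by (rule integral_unit_interval_partition[symmetric]) (use N intf in auto)
    also have "r\<^sup>2 * \<kappa> - real n * (4 * r ^ 3 / (3 * K)) = K\<^sup>2 * \<kappa> ^ 3 / (12 * (real n)\<^sup>2)"
      using n K by (simp add: r_def field_simps power3_eq_cube power2_eq_square)
    finally show ?thesis by (simp add: f_def)
  qed
  have "(\<lambda>n. K * \<kappa> / real n) \<longlonglongrightarrow> 0"
    by (rule lim_const_over_n)
  then have "\<forall>\<^sub>F n in sequentially. K * \<kappa> / real n < d"
    using d by (rule order_tendstoD)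
  then show ?thesis
    using eventually_gt_at_top[of 0]
    by eventually_elim (use main in auto)
qed

section \<open>The coefficient of a curve of constant speed\<close>

text \<open>Asking in \<open>pieces\<close> for every \<open>K < L\<close> admits curved arcs, cut
  more finely as \<open>K\<close> approaches \<open>L\<close>. Comparing open parameter pieces lets
  neighbouring pieces share an endpoint and lets the curve close up.\<close>

theorem has_quantization_coefficient_uniform_on_curve:
  fixes g :: "real \<Rightarrow> 'a::euclidean_space"
  assumes lip: "L-lipschitz_on {0..1} g" and L: "L > 0" and X: "finite X"
    and speed: "\<And>t. t \<in> {0..1} - X \<Longrightarrow> norm (vector_derivative g (at t within {0..1})) = L"
    and pieces: "\<And>K. 0 < K \<Longrightarrow> K < L \<Longrightarrow> \<exists>N>0. \<exists>v.
        (\<forall>j<N. norm (v j) = 1 \<and>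
           (\<forall>s t. real j / real N \<le> s \<longrightarrow> s \<le> t \<longrightarrow> t \<le> real (Suc j) / real N \<longrightarrow>
              K * (t - s) \<le> v j \<bullet> (g t - g s))) \<and>
        (\<forall>i<N. \<forall>j<N. i \<noteq> j \<longrightarrow>
           (\<forall>s\<in>{real i / real N<..<real (Suc i) / real N}.
            \<forall>t\<in>{real j / real N<..<real (Suc j) / real N}. g s \<noteq> g t))"
  shows "has_quantization_coefficient (uniform_on_curve g) (L\<^sup>2 / 12)"
  unfolding has_quantization_coefficient_def
\<comment> \<open>The midpoint sets keep the sequence below its limit for all n > 0, so it remains
  to exceed each smaller value eventually.\<close>
proof (rule increasing_tendsto)
  let ?P = "uniform_on_curve g"
  let ?D = "\<lambda>n. {distortion ?P \<alpha> |\<alpha>. finite \<alpha> \<and> 1 \<le> card \<alpha> \<and> card \<alpha> \<le> n}"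
  have cont: "continuous_on {0..1} g" by (rule lipschitz_on_continuous_on[OF lip])
  have dist: "distortion ?P \<alpha> = integral {0..1} (\<lambda>t. MIN a\<in>\<alpha>. (norm (g t - a))\<^sup>2)"
    if "finite \<alpha>" "1 \<le> card \<alpha>" for \<alpha>
    using that by (intro distortion_uniform_on_curve[OF cont X L speed]) auto
  have bdd: "bdd_below (?D n)" for n
    by (rule bdd_belowI[of _ 0]) (auto intro!: distortion_nonneg)
  show "\<forall>\<^sub>F n in sequentially. (real n)\<^sup>2 * quantization_error n ?P \<le> L\<^sup>2 / 12"
    using eventually_gt_at_top[of 0]
  proof eventually_elim
    fix n :: nat assume n: "0 < n"
    let ?\<alpha> = "(\<lambda>i. g ((2 * real i + 1) / (2 * real n))) ` {..<n}"
    have "finite ?\<alpha>" "1 \<le> card ?\<alpha>" "card ?\<alpha> \<le> n"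
      using n card_image_le[of "{..<n}"] by (auto simp: Suc_le_eq card_gt_0_iff)
    then have "quantization_error n ?P \<le> distortion ?P ?\<alpha>"
      unfolding quantization_error_def by (intro cInf_lower bdd) blast
    also have "\<dots> \<le> L\<^sup>2 / (12 * (real n)\<^sup>2)"
      using dist[of ?\<alpha>] distortion_midpoints_le[OF lip n] \<open>1 \<le> card ?\<alpha>\<close> by simp
    finally show "(real n)\<^sup>2 * quantization_error n ?P \<le> L\<^sup>2 / 12"
      using n by (simp add: field_simps)
  qed
  fix x assume x: "x < L\<^sup>2 / 12"
  \<comment> \<open>One parameter serves both losses: \<kappa> is the shrinking factor, and the rate
    is K = L \<kappa>.\<close>
  have "((\<lambda>\<kappa>. (L * \<kappa>)\<^sup>2 * \<kappa> ^ 3 / 12) \<longlongrightarrow> (L * 1)\<^sup>2 * 1 ^ 3 / 12) (at_left (1::real))"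
    by (intro tendsto_intros) simp
  then have "\<forall>\<^sub>F \<kappa> in at_left 1. x < (L * \<kappa>)\<^sup>2 * \<kappa> ^ 3 / 12"
    by (rule order_tendstoD) (use x in simp)
  moreover have "\<forall>\<^sub>F \<kappa> in at_left 1. 0 < \<kappa> \<and> \<kappa> < (1::real)"
    using eventually_at_left_real[of 0 1] by (auto elim: eventually_mono)
  ultimately have "\<forall>\<^sub>F \<kappa> in at_left 1. x < (L * \<kappa>)\<^sup>2 * \<kappa> ^ 3 / 12 \<and> 0 < \<kappa> \<and> \<kappa> < 1"
    by (rule eventually_conj)
  then obtain \<kappa> where \<kappa>: "x < (L * \<kappa>)\<^sup>2 * \<kappa> ^ 3 / 12" "0 < \<kappa>" "\<kappa> < 1"
    using eventually_happens'[OF trivial_limit_at_left_real] by blast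
  have K: "0 < L * \<kappa>" "L * \<kappa> < L" using L \<kappa> by auto
  obtain N v where N: "N > 0"
    and v: "\<forall>j<N. norm (v j) = 1 \<and>
       (\<forall>s t. real j / real N \<le> s \<longrightarrow> s \<le> t \<longrightarrow> t \<le> real (Suc j) / real N \<longrightarrow>
          L * \<kappa> * (t - s) \<le> v j \<bullet> (g t - g s))"
    and inj: "\<forall>i<N. \<forall>j<N. i \<noteq> j \<longrightarrow>
       (\<forall>s\<in>{real i / real N<..<real (Suc i) / real N}.
        \<forall>t\<in>{real j / real N<..<real (Suc j) / real N}. g s \<noteq> g t)"
    using pieces[OF K] by (elim exE conjE)
  have v1: "norm (v j) = 1" if "j < N" for j
    using v that by simp
  have v2: "L * \<kappa> * (t - s) \<le> v j \<bullet> (g t - g s)"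
    if "j < N" "real j / real N \<le> s" "s \<le> t" "t \<le> real (Suc j) / real N" for j s t
    using v[rule_format, OF that(1), THEN conjunct2, rule_format, OF that(2-4)] .
  have "\<forall>\<^sub>F n in sequentially. \<forall>\<alpha>. finite \<alpha> \<and> 1 \<le> card \<alpha> \<and> card \<alpha> \<le> n \<longrightarrow>
           (L * \<kappa>)\<^sup>2 * \<kappa> ^ 3 / (12 * (real n)\<^sup>2) \<le> integral {0..1} (\<lambda>t. MIN a\<in>\<alpha>. (norm (g t - a))\<^sup>2)"
    by (rule eventually_distortion_ge[OF cont N K(1) \<kappa>(2,3) v1 v2 inj[rule_format]])
  then show "\<forall>\<^sub>F n in sequentially. x < (real n)\<^sup>2 * quantization_error n ?P"
    using eventually_gt_at_top[of 0]
  proof eventually_elim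
    case (elim n)
    have "?D n \<noteq> {}" using elim(2) by (auto intro!: exI[of _ "{0}"])
    then have "(L * \<kappa>)\<^sup>2 * \<kappa> ^ 3 / (12 * (real n)\<^sup>2) \<le> quantization_error n ?P"
      unfolding quantization_error_def by (rule cInf_greatest) (use elim(1) dist in auto)
    then have "(L * \<kappa>)\<^sup>2 * \<kappa> ^ 3 / 12 \<le> (real n)\<^sup>2 * quantization_error n ?P"
      using elim(2) by (simp add: field_simps)
    then show ?case using \<kappa>(1) by linarith
  qed
qed

section \<open>The unit circle\<close>

lemma unit_circle_point_eq: "unit_circle_point c \<theta> = c + unit_circle_point 0 \<theta>"
  by (simp add: unit_circle_point_def)

lemma inner_unit_circle_point:
  "unit_circle_point 0 \<alpha> \<bullet> unit_circle_point 0 \<beta> = cos (\<alpha> - \<beta>)"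
  by (simp add: unit_circle_point_def inner_vec_def sum_2 cos_diff)

lemma norm_unit_circle_point [simp]: "norm (unit_circle_point 0 \<theta>) = 1"
  by (simp add: norm_eq_sqrt_inner inner_unit_circle_point)

lemma norm_diff_unit_circle_point:
  "norm (unit_circle_point c \<alpha> - unit_circle_point c \<beta>) = 2 * \<bar>sin ((\<alpha> - \<beta>) / 2)\<bar>"
proof -
  have half: "2 * ((\<alpha> - \<beta>) / 2) = \<alpha> - \<beta>" by simp
  have "(norm (unit_circle_point c \<alpha> - unit_circle_point c \<beta>))\<^sup>2
      = (norm (unit_circle_point 0 \<alpha> - unit_circle_point 0 \<beta>))\<^sup>2"
    by (simp add: unit_circle_point_def)
  also have "\<dots> = 2 - 2 * cos (\<alpha> - \<beta>)"
    using cos_minus[of "\<alpha> - \<beta>"]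
    by (simp add: power2_norm_eq_inner inner_diff_left inner_diff_right inner_unit_circle_point)
  also have "\<dots> = (2 * \<bar>sin ((\<alpha> - \<beta>) / 2)\<bar>)\<^sup>2"
    using cos_double_sin[of "(\<alpha> - \<beta>) / 2", unfolded half] by (simp add: power_mult_distrib)
  finally show ?thesis by (rule power2_eq_imp_eq) simp_all
qed

lemma norm_diff_unit_circle_path:
  "norm (unit_circle_path s - unit_circle_path t) = 2 * \<bar>sin (pi * (s - t))\<bar>"
proof -
  have "(2 * pi * s - 2 * pi * t) / 2 = pi * (s - t)" by (simp add: field_simps)
  then show ?thesis by (simp add: unit_circle_path_def norm_diff_unit_circle_point)
qed

text \<open>Mean value theorem: on \<open>{-b..b}\<close> the cosine is least at the ends. It
  measures how fast an arc of half-angle \<open>b\<close> advances along the tangent at its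
  middle.\<close>

lemma sin_diff_ge:
  assumes "0 \<le> b" "b \<le> pi" "- b \<le> x" "x \<le> y" "y \<le> b"
  shows "cos b * (y - x) \<le> sin y - sin x"
proof (cases "x = y")
  case False
  then obtain z where z: "x < z" "z < y" "sin y - sin x = (y - x) * cos z"
    using assms MVT2[of x y sin cos] by (auto intro: DERIV_sin)
  have "cos b \<le> cos \<bar>z\<bar>"
    using assms z by (intro cos_monotone_0_pi_le) auto
  then show ?thesis using z assms by (simp add: mult.commute mult_left_mono)
qed simp

lemma disjoint_pieces:
  assumes "i \<noteq> j" "N > 0"
    and "s \<in> {real i / real N<..<real (Suc i) / real N}"
    and "t \<in> {real j / real N<..<real (Suc j) / real N}"
  shows "s \<noteq> t"
proof -
  have "real (Suc i) / real N \<le> real j / real N \<or> real (Suc j) / real N \<le> real i / real N"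
    using assms(1,2) by (cases "i < j") (auto simp: divide_right_mono)
  then show ?thesis using assms(3,4) by auto
qed

text \<open>The circle has speed 2 pi. Cut into \<open>N\<close> equal arcs, each advances along its
  middle tangent at rate at least 2 pi cos(pi/N), which tends to 2 pi.\<close>

lemma has_quantization_coefficient_uniform_unit_circle:
  "has_quantization_coefficient uniform_unit_circle (pi\<^sup>2 / 3)"
proof -
  have "has_quantization_coefficient (uniform_on_curve unit_circle_path) ((2 * pi)\<^sup>2 / 12)"
  proof (rule has_quantization_coefficient_uniform_on_curve)
    show "(2 * pi)-lipschitz_on {0..1} unit_circle_path"
    proof (rule lipschitz_onI)
      fix s t :: real
      show "dist (unit_circle_path s) (unit_circle_path t) \<le> 2 * pi * dist s t"
        using abs_sin_x_le_abs_x[of "pi * (s - t)"]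
        by (simp add: dist_norm norm_diff_unit_circle_path abs_mult)
    qed simp
    show "finite ({} :: real set)" by simp
    show "norm (vector_derivative unit_circle_path (at t within {0..1})) = 2 * pi"
      if "t \<in> {0..1} - {}" for t
    proof -
      have "unit_circle_path = (\<lambda>t. cos (2 * pi * t) *\<^sub>R vector [1, 0] + sin (2 * pi * t) *\<^sub>R vector [0, 1])"
        by (auto simp: fun_eq_iff unit_circle_path_def unit_circle_point_def vec_eq_iff forall_2)
      moreover have "(\<dots> has_vector_derivative
          ((2 * pi) *\<^sub>R unit_circle_point 0 (2 * pi * t + pi / 2))) (at t within {0..1})"
        by (auto intro!: derivative_eq_intros
            simp: unit_circle_point_def vec_eq_iff forall_2 cos_add sin_add)
      ultimately show ?thesis
        using that by (simp add: vector_derivative_within_closed_interval)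
    qed
    fix K assume K: "0 < K" "K < 2 * pi"
    have "(\<lambda>N. 2 * pi * cos (pi / real N)) \<longlonglongrightarrow> 2 * pi * cos 0"
      by (intro tendsto_intros lim_const_over_n)
    then have "\<forall>\<^sub>F N in sequentially. K < 2 * pi * cos (pi / real N)"
      by (rule order_tendstoD) (use K in simp)
    then have "\<forall>\<^sub>F N in sequentially. K < 2 * pi * cos (pi / real N) \<and> N > 0"
      using eventually_gt_at_top by (rule eventually_conj)
    then obtain N where N: "N > 0" "K < 2 * pi * cos (pi / real N)"
      using eventually_happens'[OF sequentially_bot] by blast
    \<comment> \<open>The angle of the middle of the \<open>j\<close>-th arc; adding
      \<open>pi / 2\<close> gives the direction of the tangent there.\<close>
    define \<theta> where "\<theta> = (\<lambda>j. 2 * pi * (real j + 1 / 2) / real N)"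
    have "K * (t - s) \<le> unit_circle_point 0 (\<theta> j + pi / 2) \<bullet> (unit_circle_path t - unit_circle_path s)"
      if st: "real j / real N \<le> s" "s \<le> t" "t \<le> real (Suc j) / real N" for j s t
    proof -
      have lo: "- (pi / real N) \<le> 2 * pi * s - \<theta> j"
        using mult_left_mono[OF st(1), of "2 * pi"] by (simp add: \<theta>_def add_divide_distrib ring_distribs)
      have hi: "2 * pi * t - \<theta> j \<le> pi / real N"
        using mult_left_mono[OF st(3), of "2 * pi"] by (simp add: \<theta>_def add_divide_distrib ring_distribs)
      have "K * (t - s) \<le> 2 * pi * cos (pi / real N) * (t - s)"
        using N st by (intro mult_right_mono) auto
      also have "\<dots> = cos (pi / real N) * ((2 * pi * t - \<theta> j) - (2 * pi * s - \<theta> j))"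
        by (simp add: algebra_simps)
      also have "\<dots> \<le> sin (2 * pi * t - \<theta> j) - sin (2 * pi * s - \<theta> j)"
        by (rule sin_diff_ge) (use N lo hi st in \<open>auto simp: field_simps\<close>)
      also have "\<dots> = unit_circle_point 0 (\<theta> j + pi / 2) \<bullet> (unit_circle_path t - unit_circle_path s)"
      proof -
        have "cos (\<theta> j + pi / 2 - x) = sin (x - \<theta> j)" for x
          using cos_sin_eq[of "\<theta> j + pi / 2 - x"] by simp
        then show ?thesis
          by (simp add: unit_circle_path_def inner_diff_right inner_unit_circle_point)
      qed
      finally show ?thesis .
    qed
    moreover have "unit_circle_path s \<noteq> unit_circle_path t"
      if ij: "i < N" "j < N" "i \<noteq> j" and s: "s \<in> {real i / real N<..<real (Suc i) / real N}"
        and t: "t \<in> {real j / real N<..<real (Suc j) / real N}" for i j s t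
    proof -
      \<comment> \<open>Both parameters lie strictly between 0 and 1, so they differ by less than a
        full turn and the chord \<open>2 * \<bar>sin (pi * (s - t))\<bar>\<close> does not
        vanish.\<close>
      have "x \<in> {0<..<1}" if "k < N" "x \<in> {real k / real N<..<real (Suc k) / real N}" for k x
      proof -
        have "0 \<le> real k / real N" "real (Suc k) / real N \<le> 1" using that by auto
        then show ?thesis using that(2) unfolding greaterThanLessThan_iff by linarith
      qed
      then have "s \<in> {0<..<1}" "t \<in> {0<..<1}" using ij s t by blast+
      moreover have "s \<noteq> t" by (rule disjoint_pieces[OF ij(3) N(1) s t])
      ultimately have "0 < \<bar>s - t\<bar>" "\<bar>s - t\<bar> < 1" by auto
      then have "sin (pi * \<bar>s - t\<bar>) > 0" by (intro sin_gt_zero) auto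
      then have "sin (pi * (s - t)) \<noteq> 0"
        using sin_minus[of "pi * (s - t)"] by (auto simp: abs_if algebra_simps split: if_splits)
      then have "norm (unit_circle_path s - unit_circle_path t) \<noteq> 0"
        by (simp add: norm_diff_unit_circle_path)
      then show ?thesis by auto
    qed
    ultimately show "\<exists>N>0. \<exists>v. (\<forall>j<N. norm (v j) = 1 \<and>
           (\<forall>s t. real j / real N \<le> s \<longrightarrow> s \<le> t \<longrightarrow> t \<le> real (Suc j) / real N \<longrightarrow>
              K * (t - s) \<le> v j \<bullet> (unit_circle_path t - unit_circle_path s))) \<and>
        (\<forall>i<N. \<forall>j<N. i \<noteq> j \<longrightarrow>
           (\<forall>s\<in>{real i / real N<..<real (Suc i) / real N}.
            \<forall>t\<in>{real j / real N<..<real (Suc j) / real N}. unit_circle_path s \<noteq> unit_circle_path t))"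
      using N(1) by (intro exI[of _ N] exI[of _ "\<lambda>j. unit_circle_point 0 (\<theta> j + pi / 2)"] conjI allI impI ballI) auto
  qed simp
  then show ?thesis by (simp add: uniform_unit_circle_def power_mult_distrib)
qed

section \<open>Regular polygons\<close>

lemma cos_le_cos_end:
  assumes "0 \<le> p" "p \<le> x" "x \<le> 2 * pi - p"
  shows "cos x \<le> cos p"
proof (cases "x \<le> pi")
  case False
  have "cos (2 * pi - x) \<le> cos p"
    using assms False by (intro cos_monotone_0_pi_le) auto
  then show ?thesis by (simp add: cos_diff)
qed (use assms in \<open>auto intro: cos_monotone_0_pi_le\<close>)

lemma cos_less_cos_end:
  assumes "0 \<le> p" "p < x" "x < 2 * pi - p"
  shows "cos x < cos p"
proof (cases "x \<le> pi")
  case False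
  have "cos (2 * pi - x) < cos p"
    using assms False by (intro cos_monotone_0_pi) auto
  then show ?thesis by (simp add: cos_diff)
qed (use assms in \<open>auto intro: cos_monotone_0_pi\<close>)

text \<open>The two cosines are the heights of the vertices of a side lying \<open>y\<close> steps
  from a base side, measured along the outer normal of the base; cos(pi/m) is the height of the
  base. Neither vertex is higher than the base, and as m >= 3 at most one of them belongs to it, so
  interior points of the side lie strictly lower.\<close>

lemma convex_combination_cos_less:
  fixes m y \<tau> :: real
  assumes m: "m \<ge> 3" and y: "1 \<le> y" "y \<le> m - 1" and \<tau>: "0 < \<tau>" "\<tau> < 1"
  shows "(1 - \<tau>) * cos (2 * pi * (y - 1 / 2) / m) + \<tau> * cos (2 * pi * (y + 1 / 2) / m) < cos (pi / m)"
    (is "(1 - \<tau>) * ?A + \<tau> * ?B < ?p")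
proof -
  have le: "cos (2 * pi * z / m) \<le> ?p" if "1 / 2 \<le> z" "z \<le> m - 1 / 2" for z
  proof (rule cos_le_cos_end)
    show "pi / m \<le> 2 * pi * z / m"
      using that m by (intro divide_right_mono) auto
    have "2 * pi * z / m \<le> 2 * pi * (m - 1 / 2) / m"
      using that m by (intro divide_right_mono mult_left_mono) auto
    then show "2 * pi * z / m \<le> 2 * pi - pi / m" using m by (simp add: field_simps)
  qed (use m in auto)
  have less: "cos (2 * pi * z / m) < ?p" if "1 / 2 < z" "z < m - 1 / 2" for z
  proof (rule cos_less_cos_end)
    show "pi / m < 2 * pi * z / m"
      using that m by (intro divide_strict_right_mono) auto
    have "2 * pi * z / m < 2 * pi * (m - 1 / 2) / m"
      using that m by (intro divide_strict_right_mono mult_strict_left_mono) auto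
    then show "2 * pi * z / m < 2 * pi - pi / m" using m by (simp add: field_simps)
  qed (use m in auto)
  have "0 < (1 - \<tau>) * (?p - ?A) + \<tau> * (?p - ?B)"
  \<comment> \<open>If \<open>y < m - 1\<close>, the second vertex is off the base; if
    \<open>y = m - 1\<close>, the first one is. That vertex supplies the strict inequality.\<close>
  proof (cases "y < m - 1")
    case True
    then show ?thesis
      using le[of "y - 1 / 2"] less[of "y + 1 / 2"] y \<tau> by (intro add_nonneg_pos mult_nonneg_nonneg mult_pos_pos) auto
  next
    case False
    then show ?thesis
      using less[of "y - 1 / 2"] le[of "y + 1 / 2"] y \<tau> m by (intro add_pos_nonneg mult_nonneg_nonneg mult_pos_pos) auto
  qed
  then show ?thesis by (simp add: algebra_simps)
qed

text \<open>At the right end of side \<open>k\<close> the floor in the definition already selects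
  side \<open>k + 1\<close>; the two formulas agree at the common vertex.\<close>

lemma regular_polygon_path_eq:
  assumes m: "m > 0" and t: "real k / real m \<le> t" "t \<le> real (Suc k) / real m"
  shows "regular_polygon_path m c \<phi> t =
    linepath (regular_polygon_vertex m c \<phi> k) (regular_polygon_vertex m c \<phi> (Suc k)) (real m * t - real k)"
proof (cases "t = real (Suc k) / real m")
  case True
  then have mt: "real m * t = real (Suc k)" using m by simp
  have "nat \<lfloor>real m * t\<rfloor> = Suc k" unfolding mt floor_of_nat by simp
  then show ?thesis unfolding regular_polygon_path_def mt by (simp add: linepath_def)
next
  case False
  then have "t < real (Suc k) / real m" using t by simp
  then have "\<lfloor>real m * t\<rfloor> = int k"
    using m t by (intro floor_unique) (auto simp: field_simps)
  then show ?thesis by (simp add: regular_polygon_path_def)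
qed

lemma regular_polygon_path_diff:
  assumes m: "m > 0" and "real k / real m \<le> s" "s \<le> real (Suc k) / real m"
    and "real k / real m \<le> t" "t \<le> real (Suc k) / real m"
  shows "regular_polygon_path m c \<phi> t - regular_polygon_path m c \<phi> s =
    (real m * (t - s)) *\<^sub>R (regular_polygon_vertex m c \<phi> (Suc k) - regular_polygon_vertex m c \<phi> k)"
  using assms by (simp add: regular_polygon_path_eq[OF m, of k] linepath_def algebra_simps)

lemma norm_regular_polygon_side:
  assumes "m \<ge> 1"
  shows "norm (regular_polygon_vertex m c \<phi> (Suc k) - regular_polygon_vertex m c \<phi> k) = 2 * sin (pi / real m)"
proof -
  have "(\<phi> + 2 * pi * real (Suc k) / real m - (\<phi> + 2 * pi * real k / real m)) / 2 = pi / real m"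
    by (simp add: ring_distribs add_divide_distrib)
  moreover have "0 \<le> sin (pi / real m)"
    using assms by (intro sin_ge_zero) (auto simp: field_simps)
  ultimately show ?thesis
    by (simp add: regular_polygon_vertex_def norm_diff_unit_circle_point)
qed

text \<open>
  The functional \<open>\<lambda>x. (x - c) \<bullet> u\<close>, where \<open>u\<close> is the outer unit normal of the \<open>j\<close>-th side, is constantly
  \<open>cos (pi / m)\<close> on this side and smaller in the interior of every other side.
\<close>

lemma regular_polygon_path_inner_normal:
  fixes i j :: nat
  assumes m: "m > 0" and t: "real i / real m \<le> t" "t \<le> real (Suc i) / real m"
  defines "\<tau> \<equiv> real m * t - real i" and "x \<equiv> real i - real j"
  shows "(regular_polygon_path m c \<phi> t - c) \<bullet> unit_circle_point 0 (\<phi> + 2 * pi * (real j + 1 / 2) / real m)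
    = (1 - \<tau>) * cos (2 * pi * (x - 1 / 2) / real m) + \<tau> * cos (2 * pi * (x + 1 / 2) / real m)"
proof -
  let ?u = "unit_circle_point 0 (\<phi> + 2 * pi * (real j + 1 / 2) / real m)"
  have v: "(regular_polygon_vertex m c \<phi> k - c) \<bullet> ?u = cos (2 * pi * (real k - real j - 1 / 2) / real m)" for k
  proof -
    have "\<phi> + 2 * pi * real k / real m - (\<phi> + 2 * pi * (real j + 1 / 2) / real m)
        = 2 * pi * (real k - real j - 1 / 2) / real m"
      using m by (simp add: field_simps)
    then show ?thesis
      unfolding regular_polygon_vertex_def unit_circle_point_eq[of c] by (simp add: inner_unit_circle_point)
  qed
  have "regular_polygon_path m c \<phi> t - c =
      (1 - \<tau>) *\<^sub>R (regular_polygon_vertex m c \<phi> i - c) + \<tau> *\<^sub>R (regular_polygon_vertex m c \<phi> (Suc i) - c)"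
    by (simp add: regular_polygon_path_eq[OF m t] linepath_def \<tau>_def algebra_simps)
  moreover have "real (Suc i) - real j - 1 / 2 = x + 1 / 2" "real i - real j - 1 / 2 = x - 1 / 2"
    by (auto simp: x_def)
  ultimately show ?thesis
    by (simp only: inner_add_left inner_scaleR_left v)
qed

text \<open>A common point would have height cos(pi/m) along the outer normal of side
  \<open>j\<close>, being on that side, and a smaller height, being inside side
  \<open>i\<close>.\<close>

lemma regular_polygon_path_inj_sides:
  assumes m: "m \<ge> 3" and ij: "i < m" "j < m" "i \<noteq> j"
    and s: "s \<in> {real i / real m<..<real (Suc i) / real m}"
    and t: "t \<in> {real j / real m<..<real (Suc j) / real m}"
  shows "regular_polygon_path m c \<phi> s \<noteq> regular_polygon_path m c \<phi> t"
proof
  assume eq: "regular_polygon_path m c \<phi> s = regular_polygon_path m c \<phi> t"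
  let ?u = "unit_circle_point 0 (\<phi> + 2 * pi * (real j + 1 / 2) / real m)"
  define \<tau> where "\<tau> = real m * s - real i"
  define x where "x = real i - real j"
  have m0: "m > 0" and \<tau>: "0 < \<tau>" "\<tau> < 1" using m s by (auto simp: \<tau>_def field_simps)
  have x: "1 \<le> \<bar>x\<bar>" "\<bar>x\<bar> \<le> real m - 1" using ij by (auto simp: x_def)
  have "(regular_polygon_path m c \<phi> t - c) \<bullet> ?u = cos (pi / real m)"
    using regular_polygon_path_inner_normal[OF m0, of j t c \<phi> j] t cos_minus[of "pi / real m"]
    by (simp add: algebra_simps)
  moreover have "(regular_polygon_path m c \<phi> s - c) \<bullet> ?u =
      (1 - \<tau>) * cos (2 * pi * (x - 1 / 2) / real m) + \<tau> * cos (2 * pi * (x + 1 / 2) / real m)"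
    using regular_polygon_path_inner_normal[OF m0, of i s c \<phi> j] s by (simp add: \<tau>_def x_def)
  moreover have "\<dots> < cos (pi / real m)"
  proof (cases "x \<ge> 0")
    case True
    then show ?thesis using convex_combination_cos_less[of "real m" x \<tau>] m x \<tau> by simp
  next
    \<comment> \<open>Reflection in the normal: the cosine is even, so \<open>x\<close> and
      \<open>\<tau>\<close> may be replaced by \<open>- x\<close> and
      \<open>1 - \<tau>\<close>.\<close>
    case False
    have "2 * pi * (- x - 1 / 2) / real m = - (2 * pi * (x + 1 / 2) / real m)"
      "2 * pi * (- x + 1 / 2) / real m = - (2 * pi * (x - 1 / 2) / real m)"
      using m0 by (simp_all add: field_simps)
    then have "cos (2 * pi * (- x - 1 / 2) / real m) = cos (2 * pi * (x + 1 / 2) / real m)"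
      "cos (2 * pi * (- x + 1 / 2) / real m) = cos (2 * pi * (x - 1 / 2) / real m)"
      by (simp_all only: cos_minus)
    then show ?thesis
      using convex_combination_cos_less[of "real m" "- x" "1 - \<tau>"] m x \<tau> False by simp
  qed
  ultimately show False using eq by simp
qed

text \<open>Here \<open>L\<close> is the perimeter and the pieces are the \<open>m\<close> sides.
  Along its own direction a side advances at the full rate \<open>L\<close>, so the same cut serves
  every \<open>K < L\<close>.\<close>

lemma has_quantization_coefficient_uniform_regular_polygon:
  assumes m: "m \<ge> 3"
  shows "has_quantization_coefficient (uniform_regular_polygon m c \<phi>) ((real m * sin (pi / real m))\<^sup>2 / 3)"
proof -
  let ?g = "regular_polygon_path m c \<phi>"
  define E where "E = (\<lambda>k. regular_polygon_vertex m c \<phi> (Suc k) - regular_polygon_vertex m c \<phi> k)"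
  define L where "L = real m * (2 * sin (pi / real m))"
  have m0: "m > 0" using m by simp
  have "0 < sin (pi / real m)"
    using m by (intro sin_gt_zero) (auto simp: field_simps)
  then have L: "L > 0" using m by (simp add: L_def)
  have E: "real m * norm (E k) = L" for k
    using m by (simp add: E_def L_def norm_regular_polygon_side)
  have diff: "?g t - ?g s = (real m * (t - s)) *\<^sub>R E k"
    if "real k / real m \<le> s" "s \<le> real (Suc k) / real m"
      "real k / real m \<le> t" "t \<le> real (Suc k) / real m" for k s t
    unfolding E_def by (rule regular_polygon_path_diff[OF m0 that])
  have side: "\<exists>k<m. t \<in> {real k / real m..<real (Suc k) / real m}" if t: "0 \<le> t" "t < 1" for t
  proof (intro exI conjI)
    have "real m * t < real m" using t m by simp
    then show "nat \<lfloor>real m * t\<rfloor> < m" using t by (simp add: nat_less_iff floor_less_iff)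
    have "0 \<le> real m * t" using t by simp
    then have "real (nat \<lfloor>real m * t\<rfloor>) \<le> real m * t" "real m * t < real (nat \<lfloor>real m * t\<rfloor>) + 1"
      by linarith+
    then show "t \<in> {real (nat \<lfloor>real m * t\<rfloor>) / real m..<real (Suc (nat \<lfloor>real m * t\<rfloor>)) / real m}"
      using m by (simp add: field_simps)
  qed
  have "has_quantization_coefficient (uniform_on_curve ?g) (L\<^sup>2 / 12)"
  proof (rule has_quantization_coefficient_uniform_on_curve[OF _ L])
    show "L-lipschitz_on {0..1} ?g"
    proof (rule lipschitz_on_closed_Union)
      show "L-lipschitz_on {real k / real m..real (Suc k) / real m} ?g" for k
      proof (rule lipschitz_onI)
        fix s t assume "s \<in> {real k / real m..real (Suc k) / real m}" "t \<in> {real k / real m..real (Suc k) / real m}"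
        then have "?g s - ?g t = (real m * (s - t)) *\<^sub>R E k" by (intro diff) auto
        then show "dist (?g s) (?g t) \<le> L * dist s t"
          by (simp add: dist_norm abs_mult E[of k, symmetric])
      qed (use L in simp)
      \<comment> \<open>The fact \<open>side\<close> covers only \<open>t < 1\<close>; the
        additional index \<open>m\<close> takes in \<open>t = 1\<close>.\<close>
      show "{0..1} \<subseteq> (\<Union>k\<in>{..m}. {real k / real m..real (Suc k) / real m})"
      proof
        fix t :: real assume t: "t \<in> {0..1}"
        show "t \<in> (\<Union>k\<in>{..m}. {real k / real m..real (Suc k) / real m})"
        proof (cases "t = 1")
          case True
          then show ?thesis using m by (intro UN_I[of m]) (auto simp: field_simps)
        next
          case False
          then obtain k where "k < m" "t \<in> {real k / real m..<real (Suc k) / real m}"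
            using side[of t] t by auto
          then show ?thesis by (intro UN_I[of k]) auto
        qed
      qed
    qed (use L in auto)
    show "finite ((\<lambda>k. real k / real m) ` {..m})" by simp
    show "norm (vector_derivative ?g (at t within {0..1})) = L"
      if t: "t \<in> {0..1} - (\<lambda>k. real k / real m) ` {..m}" for t
    proof -
      have "t \<noteq> real m / real m" using t by blast
      then have "0 \<le> t" "t < 1" using t m0 by auto
      then obtain k where k: "k < m" "t \<in> {real k / real m..<real (Suc k) / real m}"
        using side by blast
      moreover have "t \<noteq> real k / real m" using t k by auto
      ultimately have tk: "t \<in> {real k / real m<..<real (Suc k) / real m}" by auto
      \<comment> \<open>Away from the corner parameters the path coincides near \<open>t\<close>
        with this affine map, and its derivative passes over to the path.\<close>
      have D: "((\<lambda>x. ?g t + (real m * (x - t)) *\<^sub>R E k) has_vector_derivative real m *\<^sub>R E k) (at t)"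
        by (auto intro!: derivative_eq_intros)
      have "?g t + (real m * (x - t)) *\<^sub>R E k = ?g x"
        if "x \<in> {real k / real m<..<real (Suc k) / real m}" for x
        using diff[of k t x] tk that by (simp add: algebra_simps)
      then have "(?g has_vector_derivative real m *\<^sub>R E k) (at t)"
        by (rule has_vector_derivative_transform_within_open[OF D open_greaterThanLessThan tk])
      then have "(?g has_vector_derivative real m *\<^sub>R E k) (at t within {0..1})"
        by (rule has_vector_derivative_at_within)
      then show ?thesis
        using t E[of k] by (simp add: vector_derivative_within_closed_interval)
    qed
    fix K assume K: "0 < K" "K < L"
    have E0: "norm (E k) > 0" for k using E[of k] L m0 by (metis mult_zero_right norm_ge_zero order_less_le)
    have "K * (t - s) \<le> (E k /\<^sub>R norm (E k)) \<bullet> (?g t - ?g s)"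
      if st: "real k / real m \<le> s" "s \<le> t" "t \<le> real (Suc k) / real m" for k s t
    proof -
      have normed: "(E k /\<^sub>R norm (E k)) \<bullet> (x *\<^sub>R E k) = x * norm (E k)" for x
        using E0[of k] by (simp add: dot_square_norm power2_eq_square)
      have "K * (t - s) \<le> L * (t - s)" using K st by (intro mult_right_mono) auto
      also have "\<dots> = (E k /\<^sub>R norm (E k)) \<bullet> ((real m * (t - s)) *\<^sub>R E k)"
        unfolding normed E[of k, symmetric] by (simp only: mult_ac)
      also have "(real m * (t - s)) *\<^sub>R E k = ?g t - ?g s"
        by (rule diff[symmetric]) (use st in auto)
      finally show ?thesis .
    qed
    then show "\<exists>N>0. \<exists>v. (\<forall>j<N. norm (v j) = 1 \<and>
           (\<forall>s t. real j / real N \<le> s \<longrightarrow> s \<le> t \<longrightarrow> t \<le> real (Suc j) / real N \<longrightarrow>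
              K * (t - s) \<le> v j \<bullet> (?g t - ?g s))) \<and>
        (\<forall>i<N. \<forall>j<N. i \<noteq> j \<longrightarrow>
           (\<forall>s\<in>{real i / real N<..<real (Suc i) / real N}.
            \<forall>t\<in>{real j / real N<..<real (Suc j) / real N}. ?g s \<noteq> ?g t))"
      using m0 E0 regular_polygon_path_inj_sides[OF m]
      by (intro exI[of _ m] exI[of _ "\<lambda>k. E k /\<^sub>R norm (E k)"] conjI allI impI ballI) auto
  qed
  moreover have "L\<^sup>2 / 12 = (real m * sin (pi / real m))\<^sup>2 / 3"
    by (simp add: L_def power_mult_distrib)
  ultimately show ?thesis by (simp add: uniform_regular_polygon_def)
qed

section \<open>Monotonicity and limit of m sin(pi/m)\<close>

text \<open>Strict decrease of sin x / x, with denominators cleared. By the mean value theorem the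
  sine has slope cos w over \<open>{0..x}\<close> and slope cos z over \<open>{x..y}\<close> with w
  < x < z, and the cosine decreases up to pi.\<close>

lemma mult_sin_less:
  fixes x y :: real
  assumes "0 < x" "x < y" "y \<le> pi"
  shows "x * sin y < y * sin x"
proof -
  obtain z where z: "x < z" "z < y" "sin y - sin x = (y - x) * cos z"
    using assms MVT2[of x y sin cos] by (auto intro: DERIV_sin)
  obtain w where w: "0 < w" "w < x" "sin x - sin 0 = (x - 0) * cos w"
    using assms MVT2[of 0 x sin cos] by (auto intro: DERIV_sin)
  have "cos z < cos w" using z w assms by (intro cos_monotone_0_pi) auto
  then have "x * (y - x) * cos z < x * (y - x) * cos w"
    using assms by (intro mult_strict_left_mono) auto
  then have "x * (sin y - sin x) < (y - x) * sin x"
    using z w by (simp add: mult_ac)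
  then show ?thesis by (simp add: algebra_simps)
qed

lemma tendsto_mult_sin_pi_over: "(\<lambda>m. real m * sin (pi / real m)) \<longlonglongrightarrow> pi"
proof -
  have "(\<lambda>h. (sin (0 + h) - sin 0) / h) \<midarrow>0\<rightarrow> cos (0::real)"
    using DERIV_sin[of "0::real"] by (simp only: DERIV_def)
  then have "((\<lambda>h::real. sin h / h) \<longlongrightarrow> 1) (at 0)" by simp
  moreover have "filterlim (\<lambda>m. pi / real m) (at 0) sequentially"
    using lim_const_over_n[of pi] eventually_gt_at_top[of 0]
    by (auto simp: filterlim_at elim: eventually_mono)
  ultimately have "(\<lambda>m. pi * (sin (pi / real m) / (pi / real m))) \<longlonglongrightarrow> pi * 1"
    by (intro tendsto_mult tendsto_const) (rule filterlim_compose)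
  then show ?thesis by (simp add: mult_ac)
qed

theorem mainTheorem2:
  fixes c :: "nat \<Rightarrow> real^2" and \<phi> :: "nat \<Rightarrow> real"
    and P :: "nat \<Rightarrow> (real^2) measure" and Q :: "nat \<Rightarrow> real"
  assumes P: "\<And>m. m \<ge> 3 \<Longrightarrow> P m = uniform_regular_polygon m (c m) (\<phi> m)"
    and Q: "\<And>m. m \<ge> 3 \<Longrightarrow> Q m = quantization_coefficient (P m)"
  shows "(\<forall>m\<ge>3. has_quantization_coefficient (P m) (Q m)) \<and>
         strict_mono_on {3..} Q \<and>
         Q \<longlonglongrightarrow> pi\<^sup>2 / 3 \<and>
         has_quantization_coefficient uniform_unit_circle (pi\<^sup>2 / 3)"
proof -
  have coeff: "has_quantization_coefficient (P m) ((real m * sin (pi / real m))\<^sup>2 / 3)" if "m \<ge> 3" for m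
    unfolding P[OF that] by (rule has_quantization_coefficient_uniform_regular_polygon[OF that])
  have Q_eq: "Q m = (real m * sin (pi / real m))\<^sup>2 / 3" if "m \<ge> 3" for m
    using coeff[OF that] unfolding Q[OF that] has_quantization_coefficient_def quantization_coefficient_def
    by (rule limI)
  have "strict_mono_on {3..} Q"
  proof (rule strict_mono_onI)
    fix k m :: nat assume km: "k \<in> {3..}" "m \<in> {3..}" "k < m"
    \<comment> \<open>From \<open>k < m\<close> follows pi/m < pi/k, so the decrease of sin x / x
      becomes an increase in the index. Squaring it relies on the nonnegativity shown below.\<close>
    have "pi / real m * sin (pi / real k) < pi / real k * sin (pi / real m)"
      using km by (intro mult_sin_less) (auto simp: field_simps)
    then have "real k * sin (pi / real k) < real m * sin (pi / real m)"
      using km by (simp add: field_simps)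
    moreover have "0 \<le> real k * sin (pi / real k)"
      using km by (intro mult_nonneg_nonneg sin_ge_zero) (auto simp: field_simps)
    ultimately show "Q k < Q m"
      using km by (simp add: Q_eq power_strict_mono divide_strict_right_mono)
  qed
  moreover have "Q \<longlonglongrightarrow> pi\<^sup>2 / 3"
  \<comment> \<open>\<open>Q\<close> is given only from index 3 on, so the closed form equals it
    eventually.\<close>
  proof (rule Lim_transform_eventually)
    show "(\<lambda>m. (real m * sin (pi / real m))\<^sup>2 / 3) \<longlonglongrightarrow> pi\<^sup>2 / 3"
      by (intro tendsto_intros tendsto_mult_sin_pi_over) simp
    show "\<forall>\<^sub>F m in sequentially. (real m * sin (pi / real m))\<^sup>2 / 3 = Q m"
      using eventually_ge_at_top[of 3] by eventually_elim (simp add: Q_eq)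
  qed
  moreover have "has_quantization_coefficient (P m) (Q m)" if "m \<ge> 3" for m
    unfolding Q_eq[OF that] by (rule coeff[OF that])
  ultimately show ?thesis
    using has_quantization_coefficient_uniform_unit_circle by blast
qed

end
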